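(* Let $n\ge 1$ be an integer. The characteristic polynomial $P_n(\lambda)=\det(\lambda I-A)$ of the adjacency matrix $A$ of the star semigraph $S^3_{2,n}$ is $$P_n(\lambda)=\lambda^{n-1}(\lambda+2)\left(\lambda^3-2\lambda^2-\frac{n+8}{4}\,\lambda+\frac n2\right).$$
   Context: A semigraph is a pair $G=(V,E)$, where $V$ is a non-empty finite set (vertices) and $E$ is a set of ordered $k$-tuples ($k\ge 2$, $k$ may vary) of distinct vertices (edges), such that any two distinct edges have at most one vertex in common; an edge $(u_1,\dots,u_k)$ is identified with its reversal $(u_k,\dots,u_1)$. For an edge $(u_1,\dots,u_k)$, $u_1,u_k$ are its end vertices and $u_2,\dots,u_{k-1}$ its middle vertices. A vertex is a pure end vertex if it is an end vertex of every edge containing it; a pure middle vertex if it is a middle vertex of every edge containing it; a middle end vertex if it is a middle vertex of at least one edge and an end vertex of at least one other edge. An edge $(u_1,\dots,u_k)$, $k\ge2$, is a full edge if $u_1,u_k$ are pure end vertices. An edge with $k>2$ is a half edge if at least one of $u_1,u_k$ is a middle end vertex. An edge $(u_1,u_2)$ with two vertices is a quarter edge if both are middle end vertices, and a half edge if exactly one is a middle end vertex and the other is a pure end vertex. For a half edge $(u_1,\dots,u_k)$ with $k>2$, the pair $(u_1,u_2)$ is a partial half edge if $u_1$ is a middle end vertex, and $(u_{k-1},u_k)$ is a partial half edge if $u_k$ is a middle end vertex; a half edge with two vertices is itself a partial half edge. For vertices $u_i,u_j$ of an edge $e=(u_1,\dots,u_k)$ put $d_e(u_i,u_j)=|i-j|$.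 The adjacency matrix of a semigraph with vertices $v_1,\dots,v_N$ is the symmetric $N\times N$ matrix $A=(a_{ij})$ with: $a_{ij}=d_e(v_i,v_j)$ if $v_i\neq v_j$ belong to a full edge or half edge $e$ and $(v_i,v_j)$ is neither a partial half edge nor a quarter edge; $a_{ij}=\frac12$ if $(v_i,v_j)$ is a partial half edge; $a_{ij}=\frac14$ if $(v_i,v_j)$ is a quarter edge; $a_{ij}=0$ otherwise. The star semigraph $S^3_{2,n}$ has vertices $v_1,\dots,v_{n+3}$, one edge $(v_2,v_1,v_3)$ with three vertices, and $n$ edges $(v_1,v_j)$, $4\le j\le n+3$, with two vertices, incident on the middle vertex $v_1$. Its adjacency matrix is the symmetric $(n+3)\times(n+3)$ matrix with $a_{12}=a_{13}=1$, $a_{23}=2$, $a_{1j}=\frac12$ for $4\le j\le n+3$, and all other entries on or above the diagonal equal to $0$. *)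

theory Defs
  imports "Jordan_Normal_Form.Char_Poly"
begin

text \<open>
  An edge \<open>(u\<^sub>1,\<dots>,u\<^sub>k)\<close> is a list. Since an edge is identified with its reversal, the edge set of a
  semigraph holds exactly one of the two orientations of each edge: having both would violate the
  pairwise intersection condition of \<open>semigraph\<close>. All notions below are invariant under reversal
  of edges.
\<close>

record 'a semigraph_data =
  verts :: "'a set"
  edges :: "'a list set"

definition semigraph :: "'a semigraph_data \<Rightarrow> bool" where
  "semigraph G \<longleftrightarrow>
     finite (verts G) \<and> verts G \<noteq> {} \<and>
     (\<forall>e\<in>edges G. length e \<ge> 2 \<and> distinct e \<and> set e \<subseteq> verts G) \<and>
     (\<forall>e\<in>edges G. \<forall>f\<in>edges G. e \<noteq> f \<longrightarrow> card (set e \<inter> set f) \<le> 1)"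

definition end_of :: "'a \<Rightarrow> 'a list \<Rightarrow> bool" where
  "end_of u e \<longleftrightarrow> u = hd e \<or> u = last e"

definition middle_of :: "'a \<Rightarrow> 'a list \<Rightarrow> bool" where
  "middle_of u e \<longleftrightarrow> (\<exists>i. 0 < i \<and> i < length e - 1 \<and> u = e ! i)"

definition pure_end :: "'a semigraph_data \<Rightarrow> 'a \<Rightarrow> bool" where
  "pure_end G u \<longleftrightarrow> u \<in> verts G \<and> (\<forall>e\<in>edges G. u \<in> set e \<longrightarrow> end_of u e)"

definition middle_end :: "'a semigraph_data \<Rightarrow> 'a \<Rightarrow> bool" where
  "middle_end G u \<longleftrightarrow> u \<in> verts G \<and>
     (\<exists>e\<in>edges G. \<exists>f\<in>edges G. e \<noteq> f \<and> middle_of u e \<and> end_of u f)"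

definition full_edge :: "'a semigraph_data \<Rightarrow> 'a list \<Rightarrow> bool" where
  "full_edge G e \<longleftrightarrow> e \<in> edges G \<and> pure_end G (hd e) \<and> pure_end G (last e)"

definition quarter_edge :: "'a semigraph_data \<Rightarrow> 'a list \<Rightarrow> bool" where
  "quarter_edge G e \<longleftrightarrow>
     e \<in> edges G \<and> length e = 2 \<and> middle_end G (hd e) \<and> middle_end G (last e)"

definition half_edge :: "'a semigraph_data \<Rightarrow> 'a list \<Rightarrow> bool" where
  "half_edge G e \<longleftrightarrow> e \<in> edges G \<and>
     (length e > 2 \<and> (middle_end G (hd e) \<or> middle_end G (last e)) \<or>
      length e = 2 \<and> (middle_end G (hd e) \<and> pure_end G (last e) \<or>
                      pure_end G (hd e) \<and> middle_end G (last e)))"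

text \<open>Pairs of vertices are unordered in the next two predicates.\<close>

definition partial_half_pair :: "'a semigraph_data \<Rightarrow> 'a \<Rightarrow> 'a \<Rightarrow> bool" where
  "partial_half_pair G u w \<longleftrightarrow> (\<exists>e. half_edge G e \<and>
     (length e > 2 \<and>
        (middle_end G (hd e) \<and> {u, w} = {e ! 0, e ! 1} \<or>
         middle_end G (last e) \<and> {u, w} = {e ! (length e - 2), e ! (length e - 1)}) \<or>
      length e = 2 \<and> {u, w} = {e ! 0, e ! 1}))"

definition quarter_pair :: "'a semigraph_data \<Rightarrow> 'a \<Rightarrow> 'a \<Rightarrow> bool" where
  "quarter_pair G u w \<longleftrightarrow> (\<exists>e. quarter_edge G e \<and> {u, w} = {e ! 0, e ! 1})"

definition pos :: "'a list \<Rightarrow> 'a \<Rightarrow> nat" where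
  "pos e u = (THE i. i < length e \<and> e ! i = u)"

definition edge_dist :: "'a list \<Rightarrow> 'a \<Rightarrow> 'a \<Rightarrow> real" where
  "edge_dist e u w = \<bar>real (pos e u) - real (pos e w)\<bar>"

text \<open>
  In a semigraph two distinct vertices lie on at most one common edge, so the definite
  description below is well defined and the first two cases exclude each other.
\<close>

definition adj_entry :: "'a semigraph_data \<Rightarrow> 'a \<Rightarrow> 'a \<Rightarrow> real" where
  "adj_entry G u w =
     (if partial_half_pair G u w then 1/2
      else if quarter_pair G u w then 1/4
      else if u \<noteq> w \<and> (\<exists>e. (full_edge G e \<or> half_edge G e) \<and> u \<in> set e \<and> w \<in> set e)
      then edge_dist (THE e. (full_edge G e \<or> half_edge G e) \<and> u \<in> set e \<and> w \<in> set e) u w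
      else 0)"

text \<open>The list \<open>vs\<close> enumerates the vertices as \<open>v\<^sub>1,\<dots>,v\<^sub>N\<close>; matrix indices start at \<open>0\<close>.\<close>

definition adjacency_matrix :: "'a semigraph_data \<Rightarrow> 'a list \<Rightarrow> real mat" where
  "adjacency_matrix G vs =
     mat (length vs) (length vs) (\<lambda>(i, j). adj_entry G (vs ! i) (vs ! j))"

text \<open>The star semigraph \<open>S\<^sup>3\<^bsub>2,n\<^esub>\<close>; the number \<open>j\<close> stands for the vertex \<open>v\<^sub>j\<close>.\<close>

definition star_semigraph :: "nat \<Rightarrow> nat semigraph_data" where
  "star_semigraph n =
     \<lparr> verts = {1..n + 3}, edges = insert [2, 1, 3] {[1, j] | j. 4 \<le> j \<and> j \<le> n + 3} \<rparr>"

lemma semigraph_star_semigraph: "semigraph (star_semigraph n)"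
proof -
  have "card (set e \<inter> set f) \<le> 1"
    if "e \<in> edges (star_semigraph n)" "f \<in> edges (star_semigraph n)" "e \<noteq> f" for e f
  proof -
    have "set e \<inter> set f \<subseteq> {1}"
      using that by (auto simp: star_semigraph_def)
    then show ?thesis
      using card_mono[of "{1::nat}"] by simp
  qed
  then show ?thesis
    by (auto simp: semigraph_def star_semigraph_def)
qed

end

theory Submission
  imports Defs
begin

text \<open>
  The leaves \<open>v\<^sub>4,\<dots>,v\<^bsub>n+3\<^esub>\<close> are pairwise non-adjacent, so \<open>\<lambda>I - A\<close> is a block matrix whose lower
  right block is \<open>\<lambda>I\<close>. Multiplying from the right by a block triangular matrix eliminates the lower
  left block (a Schur complement without division), which leaves a \<open>3 \<times> 3\<close> determinant.
\<close>

lemma det_four_block_mat_scalar_lower_right: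
  fixes P :: "'a :: idom mat"
  assumes P: "P \<in> carrier_mat k k" and Q: "Q \<in> carrier_mat k n" and R: "R \<in> carrier_mat n k"
  shows "det (four_block_mat P Q R (x \<cdot>\<^sub>m 1\<^sub>m n)) * x ^ k = det (x \<cdot>\<^sub>m P - Q * R) * x ^ n"
proof -
  let ?M = "four_block_mat P Q R (x \<cdot>\<^sub>m 1\<^sub>m n)"
  \<comment> \<open>Scaling the upper left identity by \<open>x\<close> makes \<open>R\<close> times
    \<open>x\<close> cancel against \<open>x\<close> times \<open>- R\<close> with no inverse of
    \<open>x\<close>. The price is \<open>det ?T = x ^ k\<close>, which is the extra factor on the
    left of the claim.\<close>
  let ?T = "four_block_mat (x \<cdot>\<^sub>m 1\<^sub>m k) (0\<^sub>m k n) (- R) (1\<^sub>m n)"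
  have "P * (x \<cdot>\<^sub>m 1\<^sub>m k) + Q * (- R) = x \<cdot>\<^sub>m P - Q * R"
    using P Q R by (auto simp: mult_smult_distrib[OF P])
  moreover have "P * 0\<^sub>m k n + Q * 1\<^sub>m n = Q"
    using P Q by simp
  moreover have "R * (x \<cdot>\<^sub>m 1\<^sub>m k) + (x \<cdot>\<^sub>m 1\<^sub>m n) * (- R) = 0\<^sub>m n k"
    using R by (auto simp: mult_smult_distrib[OF R] mult_smult_assoc_mat[of _ n n])
  moreover have "R * 0\<^sub>m k n + (x \<cdot>\<^sub>m 1\<^sub>m n) * 1\<^sub>m n = x \<cdot>\<^sub>m 1\<^sub>m n"
    using R by (simp add: mult_smult_assoc_mat[of _ n n])
  ultimately have "?M * ?T = four_block_mat (x \<cdot>\<^sub>m P - Q * R) Q (0\<^sub>m n k) (x \<cdot>\<^sub>m 1\<^sub>m n)"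
    using P Q R by (subst mult_four_block_mat[of _ k k _ n _ n _ _ k _ n]) auto
  moreover have "det \<dots> = det (x \<cdot>\<^sub>m P - Q * R) * x ^ n"
    using P Q R by (subst det_four_block_mat_lower_left_zero[of _ k _ n]) auto
  moreover have "det ?T = x ^ k"
    using R by (subst det_four_block_mat_upper_right_zero[of _ k _ n]) auto
  moreover have "det (?M * ?T) = det ?M * det ?T"
    using P Q R by (intro det_mult[of _ "k + n"] four_block_carrier_mat) auto
  ultimately show ?thesis by simp
qed

lemma det_dim_2:
  fixes A :: "'a :: comm_ring_1 mat"
  assumes "A \<in> carrier_mat 2 2"
  shows "det A = A $$ (0,0) * A $$ (1,1) - A $$ (0,1) * A $$ (1,0)"
proof -
  have "det (mat_delete A 0 0) = A $$ (1,1)" "det (mat_delete A 1 0) = A $$ (0,1)"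
    using assms by (subst det_single; auto simp: mat_delete_def)+
  then show ?thesis
    using assms by (subst laplace_expansion_column[of _ 2 0])
      (auto simp: cofactor_def numeral_2_eq_2)
qed

lemma det_dim_3:
  fixes A :: "'a :: comm_ring_1 mat"
  assumes "A \<in> carrier_mat 3 3"
  shows "det A =
      A $$ (0,0) * (A $$ (1,1) * A $$ (2,2) - A $$ (1,2) * A $$ (2,1))
    - A $$ (1,0) * (A $$ (0,1) * A $$ (2,2) - A $$ (0,2) * A $$ (2,1))
    + A $$ (2,0) * (A $$ (0,1) * A $$ (1,2) - A $$ (0,2) * A $$ (1,1))"
proof -
  have "det (mat_delete A 0 0) = A $$ (1,1) * A $$ (2,2) - A $$ (1,2) * A $$ (2,1)"
    "det (mat_delete A 1 0) = A $$ (0,1) * A $$ (2,2) - A $$ (0,2) * A $$ (2,1)"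
    "det (mat_delete A 2 0) = A $$ (0,1) * A $$ (1,2) - A $$ (0,2) * A $$ (1,1)"
    using assms by (subst det_dim_2; auto simp: mat_delete_def numeral_2_eq_2)+
  then show ?thesis
    using assms by (subst laplace_expansion_column[of _ 3 0])
      (auto simp: cofactor_def numeral_3_eq_3 numeral_2_eq_2 right_diff_distrib)
qed

lemma pos_nth: "distinct e \<Longrightarrow> i < length e \<Longrightarrow> pos e (e ! i) = i"
  unfolding pos_def by (rule the_equality) (auto simp: nth_eq_iff_index_eq)

context
  fixes n :: nat
  assumes n: "n \<ge> 1"
begin

lemma middle_of_star_iff:
  "e \<in> edges (star_semigraph n) \<Longrightarrow> middle_of u e \<longleftrightarrow> u = 1 \<and> e = [2, 1, 3]"
  by (auto simp: middle_of_def star_semigraph_def less_2_cases_iff intro: exI[of _ 1])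

lemma middle_end_star_iff: "middle_end (star_semigraph n) u \<longleftrightarrow> u = 1"
proof
  assume "u = 1"
  \<comment> \<open>Here \<open>n\<close> \<ge> 1 matters: the leaf edge \<open>[1, 4]\<close> makes
    1 an end vertex somewhere. With no leaves, 1 would be a pure middle vertex.\<close>
  moreover have "[2, 1, 3] \<in> edges (star_semigraph n)" "[1, 4] \<in> edges (star_semigraph n)"
    using n by (auto simp: star_semigraph_def)
  ultimately show "middle_end (star_semigraph n) u"
    unfolding middle_end_def
    by (intro conjI bexI[of _ "[2, 1, 3]"] bexI[of _ "[1, 4]"])
      (auto simp: middle_of_star_iff end_of_def star_semigraph_def)
qed (auto simp: middle_end_def middle_of_star_iff)

lemma pure_end_star_iff: "pure_end (star_semigraph n) u \<longleftrightarrow> 2 \<le> u \<and> u \<le> n + 3"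
  by (auto simp: pure_end_def star_semigraph_def end_of_def)

lemma full_edge_star_iff: "full_edge (star_semigraph n) e \<longleftrightarrow> e = [2, 1, 3]"
  unfolding full_edge_def pure_end_star_iff by (auto simp: star_semigraph_def)

text \<open>The long edge drops out because its ends 2 and 3 are not middle end vertices. Each leaf
  edge joins the only middle end vertex, 1, to a pure end vertex.\<close>

lemma half_edge_star_iff:
  "half_edge (star_semigraph n) e \<longleftrightarrow> (\<exists>j. e = [1, j] \<and> 4 \<le> j \<and> j \<le> n + 3)"
  unfolding half_edge_def pure_end_star_iff middle_end_star_iff by (auto simp: star_semigraph_def)

lemma partial_half_pair_star_iff:
  "partial_half_pair (star_semigraph n) u w \<longleftrightarrow>
     (u = 1 \<and> 4 \<le> w \<and> w \<le> n + 3) \<or> (w = 1 \<and> 4 \<le> u \<and> u \<le> n + 3)"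
  unfolding partial_half_pair_def half_edge_star_iff middle_end_star_iff
  by (auto simp: doubleton_eq_iff)

lemma not_quarter_pair_star: "\<not> quarter_pair (star_semigraph n) u w"
  unfolding quarter_pair_def quarter_edge_def middle_end_star_iff
  by (auto simp: star_semigraph_def)

lemma edge_dist_star:
  fixes u w :: nat
  assumes "u \<noteq> w" "u \<in> {1, 2, 3}" "w \<in> {1, 2, 3}"
  shows "edge_dist [2, 1, 3] u w = (if u = 1 \<or> w = 1 then 1 else 2)"
proof -
  have "pos [2, 1, 3::nat] 2 = 0" "pos [2, 1, 3::nat] 1 = 1" "pos [2, 1, 3::nat] 3 = 2"
    using pos_nth[of "[2, 1, 3::nat]" 0] pos_nth[of "[2, 1, 3::nat]" 1]
      pos_nth[of "[2, 1, 3::nat]" 2] by auto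
  then show ?thesis using assms by (auto simp: edge_dist_def)
qed

lemma adj_entry_star:
  "adj_entry (star_semigraph n) u w =
     (if (u = 1 \<and> 4 \<le> w \<and> w \<le> n + 3) \<or> (w = 1 \<and> 4 \<le> u \<and> u \<le> n + 3) then 1/2
      else if u \<noteq> w \<and> u \<in> {1, 2, 3} \<and> w \<in> {1, 2, 3} then (if u = 1 \<or> w = 1 then 1 else 2)
      else 0)"
proof (cases "partial_half_pair (star_semigraph n) u w")
  case True
  then show ?thesis
    unfolding adj_entry_def by (simp only: partial_half_pair_star_iff if_True)
next
  case False
  let ?E = "\<lambda>e. (full_edge (star_semigraph n) e \<or> half_edge (star_semigraph n) e) \<and>
              u \<in> set e \<and> w \<in> set e"
  \<comment> \<open>Two distinct vertices on a leaf edge \<open>[1, j]\<close> form a partial half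
    pair, which \<open>False\<close> excludes, so only the long edge remains.\<close>
  have E: "?E e \<longleftrightarrow> e = [2, 1, 3] \<and> u \<in> {1, 2, 3} \<and> w \<in> {1, 2, 3}" if "u \<noteq> w" for e
    using that False
    unfolding full_edge_star_iff half_edge_star_iff partial_half_pair_star_iff by auto
  have adj: "adj_entry (star_semigraph n) u w =
      (if u \<noteq> w \<and> Ex ?E then edge_dist (The ?E) u w else 0)"
    unfolding adj_entry_def if_not_P[OF False] if_not_P[OF not_quarter_pair_star] ..
  note no_leaf = if_not_P[OF False[unfolded partial_half_pair_star_iff]]
  show ?thesis
  proof (cases "u \<noteq> w \<and> u \<in> {1, 2, 3} \<and> w \<in> {1, 2, 3}")
    case True
    \<comment> \<open>Identifying the whole predicate with a singleton lets the definite description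
      in \<open>adj_entry\<close> evaluate.\<close>
    then have "?E = (\<lambda>e. e = [2, 1, 3])" using E by blast
    then have "Ex ?E" "The ?E = [2, 1, 3]" by simp_all
    with True show ?thesis
      unfolding no_leaf adj by (simp only: edge_dist_star simp_thms if_True)
  next
    case F: False
    then have "\<not> (u \<noteq> w \<and> Ex ?E)" using E by blast
    then show ?thesis
      unfolding no_leaf adj if_not_P[OF F] by (rule if_not_P)
  qed
qed

lemma char_poly_matrix_star:
  "char_poly_matrix (adjacency_matrix (star_semigraph n) [1..<n + 4]) =
     four_block_mat
       (mat 3 3 (\<lambda>(i, j). if i = j then [:0, 1:] else if i = 0 \<or> j = 0 then [:-1:] else [:-2:]))
       (mat 3 n (\<lambda>(i, j). if i = 0 then [:-1/2:] else 0))
       (mat n 3 (\<lambda>(i, j). if j = 0 then [:-1/2:] else 0))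
       ([:0, 1:] \<cdot>\<^sub>m 1\<^sub>m n)" (is "_ = four_block_mat ?P ?Q ?R ?S")
proof (rule eq_matI)
  fix i j
  assume "i < dim_row (four_block_mat ?P ?Q ?R ?S)" "j < dim_col (four_block_mat ?P ?Q ?R ?S)"
  then have "i < n + 3" "j < n + 3" by auto
  \<comment> \<open>Index \<open>i\<close> stands for vertex \<open>i + 1\<close>, so the upper left
    block belongs to the long edge, and row and column 0 to the centre.\<close>
  moreover from this have "[1..<n + 4] ! i = i + 1" "[1..<n + 4] ! j = j + 1"
    by (simp_all del: upt_Suc)
  ultimately show "char_poly_matrix (adjacency_matrix (star_semigraph n) [1..<n + 4]) $$ (i, j) =
      four_block_mat ?P ?Q ?R ?S $$ (i, j)"
    by (auto simp: char_poly_matrix_def adjacency_matrix_def adj_entry_star one_pCons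
        simp del: upt_Suc)
qed (auto simp: char_poly_matrix_def adjacency_matrix_def)

end

theorem lemma4p2:
  fixes n :: nat
  assumes "n \<ge> 1"
  shows "char_poly (adjacency_matrix (star_semigraph n) [1..<n + 4]) =
           [:0, 1:] ^ (n - 1) * [:2, 1:] *
           [:real n / 2, - ((real n + 8) / 4), - 2, 1:]"
proof -
  let ?x = "[:0, 1:] :: real poly"
  let ?c = "[:real n / 2, - ((real n + 8) / 4), - 2, 1:]"
  let ?P = "mat 3 3 (\<lambda>(i, j). if i = j then ?x else if i = 0 \<or> j = 0 then [:-1:] else [:-2:])"
  let ?Q = "mat 3 n (\<lambda>(i, j). if i = 0 then [:-1/2:] else 0) :: real poly mat"
  let ?R = "mat n 3 (\<lambda>(i, j). if j = 0 then [:-1/2:] else 0) :: real poly mat"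
  let ?p = "char_poly (adjacency_matrix (star_semigraph n) [1..<n + 4])"
  \<comment> \<open>Each of the \<open>n\<close> leaves contributes (-1/2)^2 to the diagonal entry
    of the centre; all other entries vanish since leaves meet only the centre.\<close>
  have QR: "?Q * ?R = mat 3 3 (\<lambda>(i, j). if i = 0 \<and> j = 0 then [:real n / 4:] else 0)"
    by (rule eq_matI) (auto simp: scalar_prod_def of_nat_poly)
  \<comment> \<open>The factor \<open>[:2, 1:]\<close> reflects the symmetry exchanging vertices 2
    and 3: the vector with entries 1 and -1 there and 0 elsewhere is an eigenvector of the adjacency
    matrix for -2.\<close>
  have "det (?x \<cdot>\<^sub>m ?P - ?Q * ?R) = ?x ^ 2 * [:2, 1:] * ?c"
    unfolding QR by (subst det_dim_3) (auto simp: power2_eq_square field_simps)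
  moreover have "?p * ?x ^ 3 = det (?x \<cdot>\<^sub>m ?P - ?Q * ?R) * ?x ^ n"
    unfolding char_poly_def char_poly_matrix_star[OF assms]
    by (rule det_four_block_mat_scalar_lower_right) auto
  \<comment> \<open>Splitting off one factor turns \<open>?x ^ 2 * ?x ^ n\<close> into
    \<open>?x ^ 3 * ?x ^ (n - 1)\<close>. The nonzero polynomial \<open>?x ^ 3\<close> then
    cancels.\<close>
  moreover have "?x ^ n = ?x * ?x ^ (n - 1)"
    using assms by (cases n) auto
  ultimately have "?p * ?x ^ 3 = (?x ^ (n - 1) * [:2, 1:] * ?c) * ?x ^ 3"
    by (simp only: power2_eq_square power3_eq_cube mult_ac)
  then show ?thesis
    by (subst (asm) mult_cancel_right) auto
qed

end
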